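(* Let $a$ be a positive integer with $a\equiv 5 \pmod{8}$. Then $a^{n}+1$ is not the sum of two squares for any odd positive integer $n$.
   Context: An integer $N$ is "the sum of two squares" if $N = s^2+t^2$ for some integers $s,t$ (zero is allowed). *)

theory Defs
  imports "HOL-Number_Theory.Cong"
begin

definition sum_of_two_squares :: "int \<Rightarrow> bool" where
  "sum_of_two_squares N \<longleftrightarrow> (\<exists>s t :: int. N = s\<^sup>2 + t\<^sup>2)"

end

theory Submission
  imports Defs
begin

text \<open>Modulo 8 the powers of 5 alternate between 1 and 5, so an odd power of \<open>a\<close> is again
  congruent to 5 and \<open>a ^ n + 1\<close> is congruent to 6. The squares modulo 8 are 0, 1 and 4, and
  no two of these, equal or not, add up to 6 modulo 8.\<close>

text \<open>Modulo 4 there is no obstruction, since 6 is congruent to \<open>1 + 1\<close>. Modulo 8 two odd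
  squares add up to 2, never to 6, and two even ones to a multiple of 4.\<close>
lemma not_sum_of_two_squares_if_cong_6_mod_8:
  assumes "[N = 6] (mod 8)"
  shows "\<not> sum_of_two_squares N"
proof
  have square_mod_8: "x\<^sup>2 mod 8 \<in> {0, 1, 4}" for x :: int
  proof -
    have "x mod 8 \<in> {0, 1, 2, 3, 4, 5, 6, 7}"
      by auto
    moreover have "x\<^sup>2 mod 8 = (x mod 8)\<^sup>2 mod 8"
      by (simp add: power_mod)
    ultimately show ?thesis
      by auto
  qed
  assume "sum_of_two_squares N"
  then obtain s t where "N = s\<^sup>2 + t\<^sup>2"
    unfolding sum_of_two_squares_def by blast
  then have "(s\<^sup>2 mod 8 + t\<^sup>2 mod 8) mod 8 = 6"
    using assms by (simp add: cong_def mod_add_eq)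
  then show False
    using square_mod_8[of s] square_mod_8[of t] by auto
qed

lemma odd_power_cong_5_mod_8:
  fixes a :: int
  assumes "[a = 5] (mod 8)" and "odd n"
  shows "[a ^ n = 5] (mod 8)"
proof -
  obtain k where n: "n = 2 * k + 1"
    using \<open>odd n\<close> by (elim oddE)
  have "[a\<^sup>2 = 5\<^sup>2] (mod 8)"
    using assms(1) by (rule cong_pow)
  then have "[a\<^sup>2 = 1] (mod 8)"
    by (simp add: cong_def)
  then have "[(a\<^sup>2) ^ k * a = 1 ^ k * 5] (mod 8)"
    using assms(1) by (intro cong_mult cong_pow)
  then show ?thesis
    by (simp add: n mult.commute flip: power_mult)
qed

theorem theorem1p5:
  fixes a :: int
  assumes "a > 0" and "[a = 5] (mod 8)"
  shows "\<forall>n :: nat. n > 0 \<and> odd n \<longrightarrow> \<not> sum_of_two_squares (a ^ n + 1)"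
proof (intro allI impI)
  fix n :: nat
  assume "n > 0 \<and> odd n"
  then have "[a ^ n + 1 = 5 + 1] (mod 8)"
    using assms(2) by (intro cong_add odd_power_cong_5_mod_8) auto
  then show "\<not> sum_of_two_squares (a ^ n + 1)"
    by (intro not_sum_of_two_squares_if_cong_6_mod_8) simp
qed

end
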